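(* Let $0<p<1$ be a constant. Inserting the elements $1,2,\ldots,n$ in increasing order (or $n,n-1,\ldots,1$ in decreasing order) into an initially empty binary search tree, applying \textsc{RebalanceZigZag} after each insertion, results in a binary search tree in which every node has expected depth $O(\lg n)$.
   Context: Each new element is first placed as a new leaf $v$ at its standard unbalanced BST position, and then \textsc{RebalanceZigZag}$(v)$ is applied: while $v$ has a parent and an independent coin flip shows tail (tail has probability $p$, head probability $1-p$), set $v\gets$ parent of $v$. Afterwards, if $v$ has a parent and a grandparent: if $v$ and its parent are both left children or both right children, rotate the parent of $v$ up once; otherwise rotate $v$ up twice. ("Rotating $x$ up" is the standard single rotation at the parent of $x$ that moves $x$ one level up.) The depth of a node is the number of edges from it to the root. Expectation is over the coin flips. *)

theory Defs
  imports "HOL-Library.Tree" "HOL-Probability.Probability"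
begin

datatype dir = L | R

text \<open>A node is addressed by the list of directions leading from the root down to it, so its parent
  is obtained by \<^const>\<open>butlast\<close> and its side below its parent by \<^const>\<open>last\<close>.\<close>

fun insert_leaf :: "'a::linorder \<Rightarrow> 'a tree \<Rightarrow> 'a tree" where
  "insert_leaf x \<langle>\<rangle> = \<langle>\<langle>\<rangle>, x, \<langle>\<rangle>\<rangle>"
| "insert_leaf x \<langle>l, a, r\<rangle> =
     (if x < a then \<langle>insert_leaf x l, a, r\<rangle>
      else if a < x then \<langle>l, a, insert_leaf x r\<rangle>
      else \<langle>l, a, r\<rangle>)"

text \<open>Only meaningful for search trees that contain the key.\<close>

fun node_path :: "'a::linorder \<Rightarrow> 'a tree \<Rightarrow> dir list" where
  "node_path x \<langle>\<rangle> = []"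
| "node_path x \<langle>l, a, r\<rangle> =
     (if x < a then L # node_path x l
      else if a < x then R # node_path x r
      else [])"

definition depth :: "'a::linorder \<Rightarrow> 'a tree \<Rightarrow> nat" where
  "depth x t = length (node_path x t)"

fun rot_right :: "'a tree \<Rightarrow> 'a tree" where
  "rot_right \<langle>\<langle>a, x, b\<rangle>, y, c\<rangle> = \<langle>a, x, \<langle>b, y, c\<rangle>\<rangle>"
| "rot_right t = t"

fun rot_left :: "'a tree \<Rightarrow> 'a tree" where
  "rot_left \<langle>a, x, \<langle>b, y, c\<rangle>\<rangle> = \<langle>\<langle>a, x, b\<rangle>, y, c\<rangle>"
| "rot_left t = t"

text \<open>The path argument addresses the node that moves up; afterwards that node sits at the
  \<^const>\<open>butlast\<close> of the path.\<close>

fun rotate_up :: "dir list \<Rightarrow> 'a tree \<Rightarrow> 'a tree" where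
  "rotate_up [L] t = rot_right t"
| "rotate_up [R] t = rot_left t"
| "rotate_up (L # d # ds) \<langle>l, a, r\<rangle> = \<langle>rotate_up (d # ds) l, a, r\<rangle>"
| "rotate_up (R # d # ds) \<langle>l, a, r\<rangle> = \<langle>l, a, rotate_up (d # ds) r\<rangle>"
| "rotate_up _ t = t"

text \<open>The outcome \<^const>\<open>True\<close> of a coin flip is tail. At most one flip per ancestor is made, so
  all distributions below have finite support.\<close>

fun climb :: "real \<Rightarrow> dir list \<Rightarrow> dir list pmf" where
  "climb p v =
     (if v = [] then return_pmf []
      else do {
        tail \<leftarrow> bernoulli_pmf p;
        if tail then climb p (butlast v) else return_pmf v
      })"

declare climb.simps [simp del]

definition zigzag_step :: "dir list \<Rightarrow> 'a tree \<Rightarrow> 'a tree" where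
  "zigzag_step v t =
     (if length v < 2 then t
      else if last v = last (butlast v) then rotate_up (butlast v) t
      else rotate_up (butlast v) (rotate_up v t))"

definition rebalance_zigzag :: "real \<Rightarrow> dir list \<Rightarrow> 'a tree \<Rightarrow> 'a tree pmf" where
  "rebalance_zigzag p v t = map_pmf (\<lambda>u. zigzag_step u t) (climb p v)"

definition insert_zigzag :: "real \<Rightarrow> 'a::linorder \<Rightarrow> 'a tree \<Rightarrow> 'a tree pmf" where
  "insert_zigzag p x t =
     (let t' = insert_leaf x t in rebalance_zigzag p (node_path x t') t')"

fun insert_all_zigzag :: "real \<Rightarrow> 'a::linorder list \<Rightarrow> 'a tree \<Rightarrow> 'a tree pmf" where
  "insert_all_zigzag p [] t = return_pmf t"
| "insert_all_zigzag p (x # xs) t =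
     do { t' \<leftarrow> insert_zigzag p x t; insert_all_zigzag p xs t' }"

end

theory Submission
  imports Defs "HOL-Real_Asymp.Real_Asymp"
begin

text \<open>
  Under increasing insertions the new leaf is always the bottom of the right spine, and the
  rebalancing step removes one spine node from the spine unless the climb ends within distance 1 of
  the root. A spine of size \<open>m\<close> therefore grows with probability \<open>p ^ (m - 1)\<close>, so the expectation
  of \<open>(1 / p) ^ m\<close> increases by at most a constant per insertion, and concavity of the logarithm
  makes the expected spine size \<open>O(log n)\<close>.

  The lowest spine ancestor of a fixed key \<open>k\<close>, if it has \<open>j\<close> spine nodes below it, gains one more
  with probability \<open>p ^ j\<close>, while the distance from \<open>k\<close> to the spine grows with probability at most
  a constant times \<open>p ^ j\<close>. Since \<open>j\<close> never exceeds the spine size, the expected distance of \<open>k\<close>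
  from the spine is bounded by a constant multiple of the expected spine size. Decreasing orders are
  mirror images of increasing ones.
\<close>

section \<open>Keys and search tree order\<close>

lemma inorder_rot_left [simp]: "inorder (rot_left t) = inorder t"
  by (cases t rule: rot_left.cases) auto

lemma inorder_rot_right [simp]: "inorder (rot_right t) = inorder t"
  by (cases t rule: rot_right.cases) auto

lemma inorder_rotate_up [simp]: "inorder (rotate_up v t) = inorder t"
  by (induction v t rule: rotate_up.induct) auto

lemma inorder_zigzag_step [simp]: "inorder (zigzag_step v t) = inorder t"
  by (simp add: zigzag_step_def)

lemma bst_zigzag_step [simp]: "bst (zigzag_step v t) = bst t"
  by (simp add: bst_iff_sorted_wrt_less)

lemma set_tree_zigzag_step [simp]: "set_tree (zigzag_step v t) = set_tree t"
  by (metis inorder_zigzag_step set_inorder)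

lemma set_tree_insert_leaf [simp]: "set_tree (insert_leaf x t) = insert x (set_tree t)"
  by (induction t) auto

lemma bst_insert_leaf: "bst t \<Longrightarrow> bst (insert_leaf x t)"
  by (induction t) auto

lemma insert_zigzag_bst:
  assumes "t' \<in> set_pmf (insert_zigzag p x t)" "bst t"
  shows "bst t'" "set_tree t' = insert x (set_tree t)"
  using assms by (auto simp: insert_zigzag_def rebalance_zigzag_def Let_def bst_insert_leaf)

lemma insert_all_zigzag_bst:
  assumes "t' \<in> set_pmf (insert_all_zigzag p xs t)" "bst t"
  shows "bst t' \<and> set_tree t' = set_tree t \<union> set xs"
  using assms by (induction xs arbitrary: t) (auto dest: insert_zigzag_bst)

section \<open>Expectations over finitely supported distributions\<close>

lemma climb_snoc:
  "climb p (v @ [d]) =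
     bernoulli_pmf p \<bind> (\<lambda>tail. if tail then climb p v else return_pmf (v @ [d]))"
  by (subst climb.simps) (simp cong: if_cong)

lemma climb_Nil [simp]: "climb p [] = return_pmf []"
  by (subst climb.simps) simp

lemma finite_set_pmf_climb [simp]: "finite (set_pmf (climb p v))"
  by (induction v rule: rev_induct) (auto simp: climb_snoc)

lemma finite_set_pmf_insert_zigzag [simp]: "finite (set_pmf (insert_zigzag p x t))"
  by (simp add: insert_zigzag_def rebalance_zigzag_def Let_def)

lemma finite_set_pmf_insert_all_zigzag [simp]: "finite (set_pmf (insert_all_zigzag p xs t))"
  by (induction xs arbitrary: t) auto

lemma expectation_bind_pmf_finite:
  fixes h :: "'b \<Rightarrow> real"
  assumes "finite (set_pmf M)" "\<And>x. x \<in> set_pmf M \<Longrightarrow> finite (set_pmf (f x))"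
  shows "measure_pmf.expectation (M \<bind> f) h =
    measure_pmf.expectation M (\<lambda>x. measure_pmf.expectation (f x) h)"
  using assms
  by (simp add: pmf_expectation_bind[of "set_pmf M"] integral_measure_pmf[of "set_pmf M"])

lemma expectation_mono_pmf_finite:
  fixes f g :: "'b \<Rightarrow> real"
  assumes "finite (set_pmf M)" "\<And>x. x \<in> set_pmf M \<Longrightarrow> f x \<le> g x"
  shows "measure_pmf.expectation M f \<le> measure_pmf.expectation M g"
  using assms
  by (intro integral_mono_AE integrable_measure_pmf_finite) (auto simp: AE_measure_pmf_iff)

text \<open>Additive drift, by conditioning on the first insertion. Strict sortedness preserves the
  invariant that every pending key exceeds all keys of the tree, so \<open>step\<close> applies each
  time.\<close>

lemma insert_all_zigzag_drift:
  fixes F :: "'a::linorder tree \<Rightarrow> real"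
  assumes step: "\<And>x t. bst t \<Longrightarrow> \<forall>a \<in> set_tree t. a < x \<Longrightarrow>
      measure_pmf.expectation (insert_zigzag p x t) F \<le> F t + b"
    and "sorted_wrt (<) xs" "bst t" "\<forall>a \<in> set_tree t. \<forall>x \<in> set xs. a < x"
  shows "measure_pmf.expectation (insert_all_zigzag p xs t) F \<le> F t + b * real (length xs)"
  using assms(2-)
proof (induction xs arbitrary: t)
  case Nil
  then show ?case by simp
next
  case (Cons x xs)
  let ?M = "insert_zigzag p x t"
  have "measure_pmf.expectation (insert_all_zigzag p (x # xs) t) F =
      measure_pmf.expectation ?M (\<lambda>t'. measure_pmf.expectation (insert_all_zigzag p xs t') F)"
    by (simp add: expectation_bind_pmf_finite)
  also have "\<dots> \<le> measure_pmf.expectation ?M (\<lambda>t'. F t' + b * real (length xs))"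
  proof (rule expectation_mono_pmf_finite)
    fix t' assume "t' \<in> set_pmf ?M"
    then have "bst t'" "set_tree t' = insert x (set_tree t)"
      using insert_zigzag_bst Cons.prems by blast+
    then show "measure_pmf.expectation (insert_all_zigzag p xs t') F \<le> F t' + b * real (length xs)"
      using Cons by auto
  qed simp
  also have "\<dots> = measure_pmf.expectation ?M F + b * real (length xs)"
    by (subst Bochner_Integration.integral_add) (auto intro: integrable_measure_pmf_finite)
  also have "\<dots> \<le> (F t + b) + b * real (length xs)"
    using step[of t x] Cons.prems by auto
  finally show ?case by (simp add: algebra_simps)
qed

section \<open>The climb along the right spine\<close>

text \<open>On a spine all directions agree, so the address where the climb stops is determined by
  its length; this is the law of that length for a start at depth \<open>m\<close>.\<close>

primrec climb_depth :: "real \<Rightarrow> nat \<Rightarrow> nat pmf" where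
  "climb_depth p 0 = return_pmf 0"
| "climb_depth p (Suc m) =
     bernoulli_pmf p \<bind> (\<lambda>tail. if tail then climb_depth p m else return_pmf (Suc m))"

lemma climb_replicate:
  "climb p (replicate m d) = map_pmf (\<lambda>i. replicate i d) (climb_depth p m)"
proof (induction m)
  case (Suc m)
  have "climb p (replicate (Suc m) d) = climb p (replicate m d @ [d])"
    by (simp add: replicate_append_same)
  also have "\<dots> = map_pmf (\<lambda>i. replicate i d) (climb_depth p (Suc m))"
    unfolding climb_snoc Suc climb_depth.simps map_bind_pmf
    by (intro bind_pmf_cong) (auto simp: replicate_append_same)
  finally show ?case .
qed simp

lemma set_pmf_climb_depth: "set_pmf (climb_depth p m) \<subseteq> {..m}"
  by (induction m) (auto split: if_splits)

lemma finite_set_pmf_climb_depth [simp]: "finite (set_pmf (climb_depth p m))"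
  using set_pmf_climb_depth finite_subset by blast

lemma expectation_climb_depth_Suc:
  fixes F :: "nat \<Rightarrow> real"
  assumes "0 < p" "p < 1"
  shows "measure_pmf.expectation (climb_depth p (Suc m)) F =
    p * measure_pmf.expectation (climb_depth p m) F + (1 - p) * F (Suc m)"
  using assms by (simp add: expectation_bind_pmf_finite)

text \<open>The climb gets up to depth \<open>a\<close> exactly when the first \<open>m - a\<close>
  flips are all tails.\<close>

lemma climb_depth_le:
  assumes "0 < p" "p < 1" "a \<le> m"
  shows "measure_pmf.expectation (climb_depth p m) (\<lambda>d. of_bool (d \<le> a)) = p ^ (m - a)"
  using assms(3)
proof (induction m)
  case (Suc m)
  show ?case
  proof (cases "a = Suc m")
    case True
    have "measure_pmf.expectation (climb_depth p (Suc m)) (\<lambda>d. of_bool (d \<le> a)) =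
        measure_pmf.expectation (climb_depth p (Suc m)) (\<lambda>d. 1 :: real)"
      using True set_pmf_climb_depth[of p "Suc m"]
      by (intro integral_cong_AE) (auto simp: AE_measure_pmf_iff simp del: climb_depth.simps)
    then show ?thesis using True by simp
  next
    case False
    then show ?thesis
      using Suc assms by (simp add: expectation_climb_depth_Suc Suc_diff_le del: climb_depth.simps)
  qed
qed simp

text \<open>For \<open>a <= m\<close> the climb stops at \<open>a\<close> after \<open>m - a\<close>
  tails and a head; for \<open>m < a\<close> it never does. The root is excluded because stopping
  there takes no head.\<close>

lemma climb_depth_eq:
  assumes "0 < p" "p < 1" "0 < a"
  shows "measure_pmf.expectation (climb_depth p m) (\<lambda>d. of_bool (d = a)) \<le> (1 - p) * p ^ m / p ^ a"
proof -
  have gt: "measure_pmf.expectation (climb_depth p m) (\<lambda>d. of_bool (d = a)) = (0 :: real)"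
    if "m < a" for m
    using that set_pmf_climb_depth[of p m] by (intro integral_eq_zero_AE) (auto simp: AE_measure_pmf_iff)
  show ?thesis
  proof (induction m)
    case 0
    then show ?case using assms by simp
  next
    case (Suc m)
    show ?case
    proof (cases "Suc m = a")
      case True
      then show ?thesis
        using assms gt[of m]
        by (simp add: expectation_climb_depth_Suc flip: True del: climb_depth.simps power_Suc)
    next
      case False
      have "p * measure_pmf.expectation (climb_depth p m) (\<lambda>d. of_bool (d = a)) \<le>
          p * ((1 - p) * p ^ m / p ^ a)"
        using Suc assms by (intro mult_left_mono) auto
      then show ?thesis
        using False assms
        by (simp add: expectation_climb_depth_Suc mult_ac del: climb_depth.simps)
    qed
  qed
qed

section \<open>The right spine\<close>

primrec spine_size :: "'a tree \<Rightarrow> nat" where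
  "spine_size \<langle>\<rangle> = 0"
| "spine_size \<langle>l, a, r\<rangle> = Suc (spine_size r)"

text \<open>Here \<open>spine_pos x t\<close> is the number of spine nodes below the lowest spine ancestor of \<open>x\<close>
  (possibly \<open>x\<close> itself), and \<open>spine_dist x t\<close> is the distance of \<open>x\<close> from that ancestor.\<close>

fun spine_pos :: "'a::linorder \<Rightarrow> 'a tree \<Rightarrow> nat" where
  "spine_pos x \<langle>\<rangle> = 0"
| "spine_pos x \<langle>l, a, r\<rangle> = (if x \<le> a then spine_size r else spine_pos x r)"

fun spine_dist :: "'a::linorder \<Rightarrow> 'a tree \<Rightarrow> nat" where
  "spine_dist x \<langle>\<rangle> = 0"
| "spine_dist x \<langle>l, a, r\<rangle> =
     (if x < a then Suc (depth x l) else if a < x then spine_dist x r else 0)"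

lemma depth_Node [simp]:
  "depth x \<langle>l, a, r\<rangle> = (if x < a then Suc (depth x l) else if a < x then Suc (depth x r) else 0)"
  by (simp add: depth_def)

lemma depth_Leaf [simp]: "depth x \<langle>\<rangle> = 0"
  by (simp add: depth_def)

lemma spine_pos_le: "spine_pos x t \<le> spine_size t"
  by (induction t) auto

lemma spine_pos_less: "x \<in> set_tree t \<Longrightarrow> bst t \<Longrightarrow> spine_pos x t < spine_size t"
  by (induction t) (auto simp: less_Suc_eq_le spine_pos_le)

lemma depth_le_spine: "depth x t \<le> spine_size t + spine_dist x t"
  by (induction t) auto

lemma insert_leaf_spine:
  assumes "\<forall>a \<in> set_tree t. a < x"
  shows "spine_size (insert_leaf x t) = Suc (spine_size t)"
    and "node_path x (insert_leaf x t) = replicate (spine_size t) R"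
    and "spine_pos x (insert_leaf x t) = 0"
    and "spine_dist x (insert_leaf x t) = 0"
  using assms by (induction t) auto

lemma insert_leaf_spine_other:
  assumes "\<forall>a \<in> set_tree t. a < x" "bst t" "k \<in> set_tree t"
  shows "spine_pos k (insert_leaf x t) = Suc (spine_pos k t)"
    and "spine_dist k (insert_leaf x t) = spine_dist k t"
  using assms by (induction t) (auto simp: insert_leaf_spine)

text \<open>The spine node of depth \<open>Suc i\<close> rises over the one of depth
  \<open>i\<close>, which leaves the spine as its left child. A spine node with \<open>j\<close>
  spine nodes below it has depth \<open>spine_size t - 1 - j\<close>. So the two disjuncts say that
  the spine ancestor of \<open>k\<close> is the displaced node, which sinks with its left subtree,
  or the lifted node, whose left subtree passes to the displaced node.\<close>

lemma rotate_up_spine: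
  assumes "Suc i < spine_size t" "bst t"
  shows "spine_size t = Suc (spine_size (rotate_up (replicate (Suc i) R) t)) \<and>
    spine_pos k (rotate_up (replicate (Suc i) R) t) =
      spine_pos k t - of_bool (spine_size t \<le> spine_pos k t + Suc i) \<and>
    spine_dist k (rotate_up (replicate (Suc i) R) t) \<le>
      spine_dist k t + of_bool (spine_size t = spine_pos k t + Suc i \<or>
        spine_size t = spine_pos k t + Suc (Suc i))"
  using assms
proof (induction i arbitrary: t)
  case 0
  then obtain l a b y c where t: "t = \<langle>l, a, \<langle>b, y, c\<rangle>\<rangle>"
    by (cases t rule: rot_left.cases) auto
  then show ?case
    using 0 spine_pos_le[of k c] by auto
next
  case (Suc i)
  then obtain l a r where t: "t = \<langle>l, a, r\<rangle>"
    by (cases t) auto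
  then show ?case
    using Suc.IH[of r] Suc.prems spine_pos_le[of k r] by auto
qed

text \<open>Spine nodes below the root are right children, so only the single rotation occurs: it
  lifts the parent, at depth \<open>d - 1\<close>.\<close>

lemma zigzag_step_replicate:
  "zigzag_step (replicate d R) t = (if d < 2 then t else rotate_up (replicate (d - 1) R) t)"
proof (cases "d < 2")
  case False
  then obtain e where "d = Suc (Suc e)"
    by (metis One_nat_def Suc_1 less_Suc_eq not0_implies_Suc zero_less_Suc)
  moreover have "replicate (Suc (Suc e)) R = replicate e R @ [R, R]"
    by (metis append.assoc append_Cons append_Nil replicate_Suc replicate_append_same)
  moreover have "replicate (Suc e) R = replicate e R @ [R]"
    by (simp add: replicate_append_same)
  ultimately show ?thesis
    by (simp add: zigzag_step_def butlast_append del: replicate_Suc)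
qed (simp add: zigzag_step_def)

definition spine_step :: "'a::linorder \<Rightarrow> 'a tree \<Rightarrow> nat \<Rightarrow> 'a tree" where
  "spine_step x t d = zigzag_step (replicate d R) (insert_leaf x t)"

lemma insert_zigzag_spine:
  assumes "\<forall>a \<in> set_tree t. a < x"
  shows "insert_zigzag p x t = map_pmf (spine_step x t) (climb_depth p (spine_size t))"
  by (simp add: insert_zigzag_def rebalance_zigzag_def Let_def insert_leaf_spine(2)[OF assms]
      climb_replicate map_pmf_comp spine_step_def[abs_def])

context
  fixes t :: "'a::linorder tree" and x :: 'a and d :: nat
  assumes below: "\<forall>a \<in> set_tree t. a < x" and bst: "bst t" and d: "d \<le> spine_size t"
begin

lemma spine_step_rotate:
  assumes "\<not> d < 2"
  obtains i where "d = Suc (Suc i)" "spine_step x t d = rotate_up (replicate (Suc i) R) (insert_leaf x t)"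
    "Suc i < spine_size (insert_leaf x t)" "bst (insert_leaf x t)"
proof -
  from assms obtain i where "d = Suc (Suc i)"
    by (metis One_nat_def Suc_1 less_Suc_eq not0_implies_Suc zero_less_Suc)
  then show ?thesis
    using that[of i] d bst below
    by (simp add: spine_step_def zigzag_step_replicate insert_leaf_spine bst_insert_leaf
        del: replicate_Suc)
qed

text \<open>The leaf adds a spine node and a rotation removes one, so the spine grows only when no
  rotation takes place.\<close>

lemma spine_step_size: "spine_size (spine_step x t d) = spine_size t + of_bool (d \<le> 1)"
proof (cases "d < 2")
  case True
  then show ?thesis
    using below by (simp add: spine_step_def zigzag_step_replicate insert_leaf_spine)
next
  case False
  then obtain i where i: "d = Suc (Suc i)"
    "spine_step x t d = rotate_up (replicate (Suc i) R) (insert_leaf x t)"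
    "Suc i < spine_size (insert_leaf x t)" "bst (insert_leaf x t)"
    by (rule spine_step_rotate)
  show ?thesis
    unfolding i(2) using rotate_up_spine[OF i(3,4), of x] i(1) below
    by (simp add: insert_leaf_spine del: replicate_Suc)
qed

text \<open>The new leaf has depth \<open>spine_size t\<close>, at least \<open>d\<close>, hence
  lies strictly below the lifted node and stays at the bottom of the spine.\<close>

lemma spine_step_new: "spine_pos x (spine_step x t d) = 0" "spine_dist x (spine_step x t d) = 0"
proof -
  have "spine_pos x (spine_step x t d) = 0 \<and> spine_dist x (spine_step x t d) = 0"
  proof (cases "d < 2")
    case True
    then show ?thesis
      using below by (simp add: spine_step_def zigzag_step_replicate insert_leaf_spine)
  next
    case False
    then obtain i where i: "d = Suc (Suc i)"
      "spine_step x t d = rotate_up (replicate (Suc i) R) (insert_leaf x t)"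
      "Suc i < spine_size (insert_leaf x t)" "bst (insert_leaf x t)"
      by (rule spine_step_rotate)
    show ?thesis
      unfolding i(2) using rotate_up_spine[OF i(3,4), of x] i(1) below d
      by (simp add: insert_leaf_spine del: replicate_Suc)
  qed
  then show "spine_pos x (spine_step x t d) = 0" "spine_dist x (spine_step x t d) = 0" by auto
qed

text \<open>Put \<open>a = spine_size t - spine_pos k t\<close>; the spine ancestor of
  \<open>k\<close> has depth \<open>a - 1\<close>. The new leaf adds one spine node below it, and
  displacing the node of depth \<open>d - 2\<close> cancels this when \<open>d > a\<close>. The
  distance can grow only if that ancestor is the lifted node (\<open>d = a\<close>) or the displaced
  one (\<open>d = Suc a\<close>).\<close>

lemma spine_step_old:
  assumes "k \<in> set_tree t"
  shows "spine_pos k (spine_step x t d) =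
      spine_pos k t + of_bool (d \<le> spine_size t - spine_pos k t)"
    and "spine_dist k (spine_step x t d) \<le> spine_dist k t +
      of_bool (d = spine_size t - spine_pos k t) + of_bool (d = Suc (spine_size t - spine_pos k t))"
proof -
  note less = spine_pos_less[OF assms bst]
  note old = insert_leaf_spine_other[OF below bst assms]
  have "spine_pos k (spine_step x t d) =
      spine_pos k t + of_bool (d \<le> spine_size t - spine_pos k t) \<and>
    spine_dist k (spine_step x t d) \<le> spine_dist k t +
      of_bool (d = spine_size t - spine_pos k t) + of_bool (d = Suc (spine_size t - spine_pos k t))"
  proof (cases "d < 2")
    case True
    then show ?thesis
      using less by (simp add: spine_step_def zigzag_step_replicate old)
  next
    case False
    then obtain i where i: "d = Suc (Suc i)"
      "spine_step x t d = rotate_up (replicate (Suc i) R) (insert_leaf x t)"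
      "Suc i < spine_size (insert_leaf x t)" "bst (insert_leaf x t)"
      by (rule spine_step_rotate)
    show ?thesis
      unfolding i(2) using rotate_up_spine[OF i(3,4), of k] i(1) less
      by (auto simp: insert_leaf_spine[OF below] old of_bool_def simp del: replicate_Suc
          split: if_splits)
  qed
  then show "spine_pos k (spine_step x t d) =
      spine_pos k t + of_bool (d \<le> spine_size t - spine_pos k t)"
    and "spine_dist k (spine_step x t d) \<le> spine_dist k t +
      of_bool (d = spine_size t - spine_pos k t) + of_bool (d = Suc (spine_size t - spine_pos k t))"
    by auto
qed

end

section \<open>Drift\<close>

lemma expectation_insert_zigzag:
  fixes F :: "'a::linorder tree \<Rightarrow> real"
  assumes "\<forall>a \<in> set_tree t. a < x"
  shows "measure_pmf.expectation (insert_zigzag p x t) F =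
    measure_pmf.expectation (climb_depth p (spine_size t)) (\<lambda>d. F (spine_step x t d))"
  by (simp add: insert_zigzag_spine[OF assms])

lemma spine_size_drift:
  assumes p: "0 < p" "p < 1" and t: "bst t" "\<forall>a \<in> set_tree t. a < x"
  shows "measure_pmf.expectation (insert_zigzag p x t) (\<lambda>t. (1 / p) ^ spine_size t) \<le>
    (1 / p) ^ spine_size t + (1 / p - 1) / p"
proof -
  let ?m = "spine_size t"
  let ?M = "climb_depth p ?m"
  let ?q = "measure_pmf.expectation ?M (\<lambda>d. of_bool (d \<le> 1)) :: real"
  \<comment> \<open>The exponent grows by 0 or 1, so the new power is affine in the indicator of
    growth.\<close>
  have "measure_pmf.expectation (insert_zigzag p x t) (\<lambda>t. (1 / p) ^ spine_size t) =
      measure_pmf.expectation ?M (\<lambda>d. (1 / p) ^ ?m + (1 / p) ^ ?m * (1 / p - 1) * of_bool (d \<le> 1))"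
    unfolding expectation_insert_zigzag[OF t(2)] using set_pmf_climb_depth[of p ?m]
    by (intro integral_cong_AE) (auto simp: AE_measure_pmf_iff spine_step_size t algebra_simps)
  also have "\<dots> = (1 / p) ^ ?m + (1 / p) ^ ?m * (1 / p - 1) * ?q"
    by (subst Bochner_Integration.integral_add) (auto intro: integrable_measure_pmf_finite)
  also have "(1 / p) ^ ?m * (1 / p - 1) * ?q \<le> (1 / p - 1) / p"
  proof (cases ?m)
    \<comment> \<open>An empty spine grows with certainty, so this case is bounded separately, using
      \<open>1 <= 1 / p\<close>.\<close>
    case 0
    have "(1 / p - 1) * 1 \<le> (1 / p - 1) * (1 / p)"
      using p by (intro mult_left_mono) auto
    then show ?thesis using 0 by simp
  next
    case (Suc n)
    then have "?q = p ^ n" using climb_depth_le[of p 1 ?m] p by simp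
    then show ?thesis using p Suc by (simp add: field_simps)
  qed
  finally show ?thesis by simp
qed

text \<open>Chosen so that
  \<open>(1 - p) * p ^ j + (1 - p) * p ^ j / p = dist_rate p * p ^ j\<close>: the bounds for the two
  harmful stopping nodes against the chance \<open>p ^ j\<close> that the position grows.\<close>

definition dist_rate :: "real \<Rightarrow> real" where
  "dist_rate p = (1 - p) * (1 + 1 / p)"

lemma dist_rate_nonneg: "0 < p \<Longrightarrow> p < 1 \<Longrightarrow> 0 \<le> dist_rate p"
  by (simp add: dist_rate_def)

text \<open>A supermartingale: expected growth of the distance is paid for by growth of the
  position. The value 0 for absent keys fits the moment \<open>k\<close> is inserted, when its
  position and distance are both 0.\<close>

definition spine_potential :: "real \<Rightarrow> 'a::linorder \<Rightarrow> 'a tree \<Rightarrow> real" where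
  "spine_potential p k t =
     (if k \<in> set_tree t then real (spine_dist k t) - dist_rate p * real (spine_pos k t) else 0)"

text \<open>With \<open>j = spine_pos k t\<close>, the key \<open>k\<close> moves away from the spine only if the climb stops at one of
  two specific nodes, which has probability at most \<open>dist_rate p * p ^ j\<close>.\<close>

lemma spine_potential_drift:
  assumes p: "0 < p" "p < 1" and t: "bst t" "\<forall>a \<in> set_tree t. a < x"
  shows "measure_pmf.expectation (insert_zigzag p x t) (spine_potential p k) \<le> spine_potential p k t"
proof -
  let ?m = "spine_size t"
  let ?M = "climb_depth p ?m"
  let ?E = "measure_pmf.expectation ?M :: (nat \<Rightarrow> real) \<Rightarrow> real"
  have set: "set_tree (spine_step x t d) = insert x (set_tree t)" for d
    by (simp add: spine_step_def)
  show ?thesis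
  proof (cases "k \<in> set_tree t")
    case False
    have "spine_potential p k (spine_step x t d) = 0" if "d \<in> set_pmf ?M" for d
      using False set_pmf_climb_depth[of p ?m] that spine_step_new[OF t(2,1), of d]
      by (auto simp: spine_potential_def set)
    then have "?E (\<lambda>d. spine_potential p k (spine_step x t d)) = 0"
      by (intro integral_eq_zero_AE) (auto simp: AE_measure_pmf_iff)
    then show ?thesis
      using False by (simp add: expectation_insert_zigzag t spine_potential_def)
  next
    case True
    define a where "a = ?m - spine_pos k t"
    have a: "0 < a" "a \<le> ?m"
      using spine_pos_less[OF True t(1)] by (auto simp: a_def)
    let ?C = "dist_rate p"
    have "?E (\<lambda>d. spine_potential p k (spine_step x t d)) \<le>
      ?E (\<lambda>d. spine_potential p k t +
        (of_bool (d = a) + of_bool (d = Suc a) - ?C * of_bool (d \<le> a)))"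
    proof (rule expectation_mono_pmf_finite)
      fix d assume "d \<in> set_pmf ?M"
      then have d: "d \<le> ?m" using set_pmf_climb_depth[of p ?m] by auto
      have "real (spine_dist k (spine_step x t d)) \<le>
          real (spine_dist k t + of_bool (d = a) + of_bool (d = Suc a))"
        using spine_step_old(2)[OF t(2,1) d True] unfolding a_def of_nat_le_iff .
      then show "spine_potential p k (spine_step x t d) \<le> spine_potential p k t +
          (of_bool (d = a) + of_bool (d = Suc a) - ?C * of_bool (d \<le> a))"
        using True spine_step_old(1)[OF t(2,1) d True]
        by (simp add: spine_potential_def set a_def[symmetric] algebra_simps)
    qed simp
    also have "\<dots> = spine_potential p k t + (?E (\<lambda>d. of_bool (d = a)) +
        ?E (\<lambda>d. of_bool (d = Suc a)) - ?C * ?E (\<lambda>d. of_bool (d \<le> a)))"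
      by (simp add: integrable_measure_pmf_finite)
    \<comment> \<open>If the spine ancestor of \<open>k\<close> is the bottom node, then
      \<open>Suc a\<close> exceeds \<open>?m\<close> and the second probability is 0, which the
      upper bound covers.\<close>
    also have "?E (\<lambda>d. of_bool (d = a)) + ?E (\<lambda>d. of_bool (d = Suc a)) \<le>
        (1 - p) * p ^ ?m / p ^ a + (1 - p) * p ^ ?m / p ^ Suc a"
      using p a by (intro add_mono climb_depth_eq) auto
    also have "\<dots> = ?C * p ^ (?m - a)"
      using p a by (simp add: dist_rate_def power_diff field_simps)
    also have "\<dots> = ?C * ?E (\<lambda>d. of_bool (d \<le> a))"
      using p a by (simp add: climb_depth_le)
    finally show ?thesis
      by (simp add: expectation_insert_zigzag t)
  qed
qed

section \<open>Increasing insertion orders\<close>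

lemma expected_spine_size:
  fixes xs :: "'a::linorder list"
  assumes p: "0 < p" "p < 1" and xs: "sorted_wrt (<) xs"
  shows "measure_pmf.expectation (insert_all_zigzag p xs \<langle>\<rangle>) (\<lambda>t. real (spine_size t)) \<le>
    ln (1 + (1 / p - 1) / p * real (length xs)) / ln (1 / p)"
proof -
  let ?M = "insert_all_zigzag p xs \<langle>\<rangle>"
  define c where "c = 1 + (1 / p - 1) / p * real (length xs)"
  have "1 \<le> c" using p by (simp add: c_def)
  then have c: "0 < c" by simp
  have lnp: "0 < ln (1 / p)" using p by simp
  have int: "integrable (measure_pmf ?M) f" for f :: "'a tree \<Rightarrow> real"
    by (simp add: integrable_measure_pmf_finite)
  have "measure_pmf.expectation ?M (\<lambda>t. (1 / p) ^ spine_size t) \<le>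
      (1 / p) ^ spine_size (\<langle>\<rangle> :: 'a tree) + (1 / p - 1) / p * real (length xs)"
    by (intro insert_all_zigzag_drift spine_size_drift p xs) auto
  then have E: "measure_pmf.expectation ?M (\<lambda>t. (1 / p) ^ spine_size t) \<le> c"
    by (simp add: c_def)
  have "ln (1 / p) * measure_pmf.expectation ?M (\<lambda>t. real (spine_size t)) =
      measure_pmf.expectation ?M (\<lambda>t. ln (1 / p) * real (spine_size t))"
    by simp
  \<comment> \<open>Jensen's inequality by hand: the logarithm lies below its tangent at
    \<open>c\<close>, and the tangent is at most \<open>ln c\<close> in expectation because
    \<open>c\<close> bounds the mean of the power.\<close>
  also have "\<dots> \<le> measure_pmf.expectation ?M (\<lambda>t. (1 / p) ^ spine_size t / c + (ln c - 1))"
  proof (rule expectation_mono_pmf_finite)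
    fix t :: "'a tree"
    have "ln ((1 / p) ^ spine_size t / c) \<le> (1 / p) ^ spine_size t / c - 1"
      using p c by (intro ln_le_minus_one) simp
    then show "ln (1 / p) * real (spine_size t) \<le> (1 / p) ^ spine_size t / c + (ln c - 1)"
      using p c by (simp add: ln_div ln_realpow mult.commute)
  qed simp
  also have "\<dots> = measure_pmf.expectation ?M (\<lambda>t. (1 / p) ^ spine_size t) / c + (ln c - 1)"
    using int by simp
  also have "\<dots> \<le> ln c"
    using E c by (simp add: field_simps)
  finally show ?thesis
    using lnp by (simp add: c_def field_simps)
qed

definition depth_bound :: "real \<Rightarrow> nat \<Rightarrow> real" where
  "depth_bound p n = (1 + dist_rate p) * (ln (1 + (1 / p - 1) / p * real n) / ln (1 / p))"

text \<open>The distance is the potential plus \<open>dist_rate p\<close> times the position, and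
  the position is at most the spine size. The potential has nonpositive mean, which leaves
  \<open>1 + dist_rate p\<close> times the expected spine size.\<close>

lemma expected_depth_increasing:
  fixes xs :: "'a::linorder list"
  assumes p: "0 < p" "p < 1" and xs: "sorted_wrt (<) xs" and k: "k \<in> set xs"
  shows "measure_pmf.expectation (insert_all_zigzag p xs \<langle>\<rangle>) (\<lambda>t. real (depth k t)) \<le>
    depth_bound p (length xs)"
proof -
  let ?M = "insert_all_zigzag p xs \<langle>\<rangle>"
  let ?C = "dist_rate p"
  have C: "0 \<le> ?C" using p by (simp add: dist_rate_nonneg)
  have int: "integrable (measure_pmf ?M) f" for f :: "'a tree \<Rightarrow> real"
    by (simp add: integrable_measure_pmf_finite)
  have "measure_pmf.expectation ?M (spine_potential p k) \<le>
      spine_potential p k \<langle>\<rangle> + 0 * real (length xs)"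
    using spine_potential_drift[OF p] by (intro insert_all_zigzag_drift xs) auto
  then have pot: "measure_pmf.expectation ?M (spine_potential p k) \<le> 0"
    by (simp add: spine_potential_def)
  have "measure_pmf.expectation ?M (\<lambda>t. real (depth k t)) \<le>
      measure_pmf.expectation ?M (\<lambda>t. (1 + ?C) * real (spine_size t) + spine_potential p k t)"
  proof (rule expectation_mono_pmf_finite)
    fix t assume "t \<in> set_pmf ?M"
    then have "k \<in> set_tree t" using insert_all_zigzag_bst k by fastforce
    moreover have "?C * real (spine_pos k t) \<le> ?C * real (spine_size t)"
      using C by (intro mult_left_mono) (simp_all add: spine_pos_le)
    ultimately show "real (depth k t) \<le> (1 + ?C) * real (spine_size t) + spine_potential p k t"
      using depth_le_spine[of k t] by (simp add: spine_potential_def algebra_simps)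
  qed simp
  also have "\<dots> = (1 + ?C) * measure_pmf.expectation ?M (\<lambda>t. real (spine_size t)) +
      measure_pmf.expectation ?M (spine_potential p k)"
    using int by simp
  also have "\<dots> \<le> (1 + ?C) * measure_pmf.expectation ?M (\<lambda>t. real (spine_size t))"
    using pot by simp
  also have "\<dots> \<le> depth_bound p (length xs)"
    unfolding depth_bound_def using C expected_spine_size[OF p xs] by (intro mult_left_mono) auto
  finally show ?thesis .
qed

lemma depth_bound_bigo:
  assumes "0 < p" "p < 1"
  shows "depth_bound p \<in> O(\<lambda>n. log 2 (real n))"
proof -
  define B where "B = (1 / p - 1) / p"
  have "B > 0" using assms by (simp add: B_def)
  then have "(\<lambda>n. ln (1 + B * real n)) \<in> O(\<lambda>n. log 2 (real n))"
    by real_asymp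
  moreover have "(1 + dist_rate p) / ln (1 / p) \<noteq> 0"
    using assms dist_rate_nonneg[of p] by auto
  ultimately have
    "(\<lambda>n. (1 + dist_rate p) / ln (1 / p) * ln (1 + B * real n)) \<in> O(\<lambda>n. log 2 (real n))"
    by (intro landau_o.big.cmult_in_iff[THEN iffD2])
  then show ?thesis by (simp add: depth_bound_def[abs_def] B_def)
qed

section \<open>Reflection\<close>

primrec flip :: "dir \<Rightarrow> dir" where
  "flip L = R"
| "flip R = L"

lemma flip_eq_iff [simp]: "flip a = flip b \<longleftrightarrow> a = b"
  by (cases a; cases b) auto

text \<open>Mirroring alone would reverse the search order; relabelling by an antitone
  \<open>g\<close> restores it.\<close>

definition reflect :: "('a \<Rightarrow> 'b) \<Rightarrow> 'a tree \<Rightarrow> 'b tree" where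
  "reflect g t = mirror (map_tree g t)"

lemma reflect_simps [simp]:
  "reflect g \<langle>\<rangle> = \<langle>\<rangle>"
  "reflect g \<langle>l, a, r\<rangle> = \<langle>reflect g r, g a, reflect g l\<rangle>"
  by (simp_all add: reflect_def)

lemma reflect_rot_left: "reflect g (rot_left t) = rot_right (reflect g t)"
  by (cases t rule: rot_left.cases) auto

lemma reflect_rot_right: "reflect g (rot_right t) = rot_left (reflect g t)"
  by (cases t rule: rot_right.cases) auto

lemma reflect_rotate_up: "reflect g (rotate_up v t) = rotate_up (map flip v) (reflect g t)"
  by (induction v t rule: rotate_up.induct) (auto simp: reflect_rot_left reflect_rot_right)

lemma reflect_zigzag_step: "reflect g (zigzag_step v t) = zigzag_step (map flip v) (reflect g t)"
proof (cases "length v < 2")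
  case False
  then have "v \<noteq> []" "butlast v \<noteq> []" by (auto simp flip: length_greater_0_conv)
  then show ?thesis
    using False by (simp add: zigzag_step_def reflect_rotate_up last_map flip: map_butlast)
qed (simp add: zigzag_step_def)

text \<open>The climb only shortens the path and never inspects a direction.\<close>

lemma climb_map: "climb p (map f v) = map_pmf (map f) (climb p v)"
  by (induction v rule: rev_induct)
    (auto simp: climb_snoc map_bind_pmf intro!: bind_pmf_cong)

context
  fixes g :: "'a::linorder \<Rightarrow> 'b::linorder"
  assumes antimono: "\<And>x y. x < y \<Longrightarrow> g y < g x"
begin

lemma antimono_less_iff: "g x < g y \<longleftrightarrow> y < x"
  using antimono by (metis less_asym less_irrefl linorder_neqE)

lemma reflect_insert_leaf: "reflect g (insert_leaf x t) = insert_leaf (g x) (reflect g t)"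
  by (induction t) (auto simp: antimono_less_iff)

lemma node_path_reflect: "node_path (g x) (reflect g t) = map flip (node_path x t)"
  by (induction t) (auto simp: antimono_less_iff)

lemma depth_reflect: "depth (g x) (reflect g t) = depth x t"
  by (simp add: depth_def node_path_reflect)

lemma insert_zigzag_reflect:
  "insert_zigzag p (g x) (reflect g t) = map_pmf (reflect g) (insert_zigzag p x t)"
  by (simp add: insert_zigzag_def rebalance_zigzag_def Let_def node_path_reflect climb_map
      map_pmf_comp reflect_zigzag_step flip: reflect_insert_leaf)

lemma insert_all_zigzag_reflect:
  "insert_all_zigzag p (map g xs) (reflect g t) = map_pmf (reflect g) (insert_all_zigzag p xs t)"
  by (induction xs arbitrary: t) (simp_all add: insert_zigzag_reflect bind_map_pmf map_bind_pmf)

text \<open>Carries the bound over to decreasing orders: the run on \<open>map g xs\<close> is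
  distributed as the reflected run on \<open>xs\<close>, and reflection preserves depths.\<close>

lemma expectation_depth_reflect:
  "measure_pmf.expectation (insert_all_zigzag p xs \<langle>\<rangle>) (\<lambda>t. real (depth k t)) =
   measure_pmf.expectation (insert_all_zigzag p (map g xs) \<langle>\<rangle>) (\<lambda>t. real (depth (g k) t))"
  using insert_all_zigzag_reflect[of p xs "\<langle>\<rangle>"] by (simp add: depth_reflect)

end

theorem theorem5:
  fixes p :: real and keys :: "nat \<Rightarrow> nat list"
  assumes "0 < p" and "p < 1"
    and "keys = (\<lambda>n. [1..<n + 1]) \<or> keys = (\<lambda>n. rev [1..<n + 1])"
  shows "(\<forall>n. \<forall>t \<in> set_pmf (insert_all_zigzag p (keys n) \<langle>\<rangle>). bst t \<and> set_tree t = {1..n}) \<and>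
         (\<exists>f \<in> O(\<lambda>n. log 2 (real n)). \<forall>n. \<forall>k \<in> {1..n}.
            measure_pmf.expectation (insert_all_zigzag p (keys n) \<langle>\<rangle>) (\<lambda>t. real (depth k t)) \<le> f n)"
proof (intro conjI bexI allI ballI)
  have keys: "set (keys n) = {1..n}" "length (keys n) = n" for n
    using assms(3) by auto
  show "bst t" "set_tree t = {1..n}" if "t \<in> set_pmf (insert_all_zigzag p (keys n) \<langle>\<rangle>)" for n t
    using insert_all_zigzag_bst[OF that] keys by auto
  show "depth_bound p \<in> O(\<lambda>n. log 2 (real n))"
    using assms by (intro depth_bound_bigo)
  show "measure_pmf.expectation (insert_all_zigzag p (keys n) \<langle>\<rangle>) (\<lambda>t. real (depth k t)) \<le>
      depth_bound p n" if "k \<in> {1..n}" for n k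
    using assms(3)
  proof
    assume "keys = (\<lambda>n. [1..<n + 1])"
    then have "sorted_wrt (<) (keys n)" by (simp del: upt_Suc)
    then show ?thesis
      using expected_depth_increasing[of p "keys n" k] assms that keys by simp
  next
    \<comment> \<open>The keys move to \<open>int\<close> because no strictly decreasing map from
      \<open>nat\<close> to itself exists.\<close>
    let ?g = "\<lambda>i::nat. - int i"
    assume "keys = (\<lambda>n. rev [1..<n + 1])"
    then have "sorted_wrt (<) (map ?g (keys n))"
      by (simp add: sorted_wrt_map sorted_wrt_rev del: upt_Suc)
    then have "measure_pmf.expectation (insert_all_zigzag p (map ?g (keys n)) \<langle>\<rangle>)
        (\<lambda>t. real (depth (?g k) t)) \<le> depth_bound p n"
      using expected_depth_increasing[of p "map ?g (keys n)" "?g k"] assms that keys by simp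
    then show ?thesis
      using expectation_depth_reflect[of ?g p "keys n" k] by simp
  qed
qed

end
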